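(* Let $\mathcal{F}$ be a class of simple graphs and consider the assertions: (1) $\mathcal{F}$ is closed under taking induced subgraphs; (2) $\equiv_{\mathcal{F}}$ is preserved under left lexicographic products, i.e.\ for all simple graphs $G,H,H'$, if $H\equiv_{\mathcal{F}}H'$ then $G\cdot H\equiv_{\mathcal{F}}G\cdot H'$; (3) $\mathrm{cl}(\mathcal{F})$ is closed under taking induced subgraphs. Then (1) implies (2), and (2) and (3) are equivalent.
   Context: All graphs are finite, undirected, without multiple edges; simple means without loops. $\hom(F,G)$ counts homomorphisms $F\to G$; $G\equiv_{\mathcal{F}}H$ means $\hom(F,G)=\hom(F,H)$ for all $F\in\mathcal{F}$; $\mathrm{cl}(\mathcal{F})$ is the class of all simple graphs $K$ such that for all simple $G,H$, $G\equiv_{\mathcal{F}}H$ implies $\hom(K,G)=\hom(K,H)$. The lexicographic product $G\cdot H$ has vertex set $V(G)\times V(H)$, with $(g,h)$ adjacent to $(g',h')$ iff either $g=g'$ and $hh'\in E(H)$, or $gg'\in E(G)$. *)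

theory Defs
  imports Main "HOL-Library.FuncSet" "HOL-Library.Nat_Bijection"
begin

text \<open>A (finite, undirected) graph: vertex set and a symmetric edge relation on it.
  Vertices are natural numbers; every finite graph is isomorphic to one of these.\<close>
type_synonym graph = "nat set \<times> (nat \<times> nat) set"

definition verts :: "graph \<Rightarrow> nat set" where "verts G = fst G"
definition edges :: "graph \<Rightarrow> (nat \<times> nat) set" where "edges G = snd G"

definition simple_graph :: "graph \<Rightarrow> bool" where
  "simple_graph G \<longleftrightarrow> finite (verts G) \<and> edges G \<subseteq> verts G \<times> verts G
     \<and> (\<forall>u v. (u, v) \<in> edges G \<longrightarrow> (v, u) \<in> edges G)
     \<and> (\<forall>v. (v, v) \<notin> edges G)"

definition hom :: "graph \<Rightarrow> graph \<Rightarrow> nat" where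
  "hom F G = card {f \<in> verts F \<rightarrow>\<^sub>E verts G.
       \<forall>u v. (u, v) \<in> edges F \<longrightarrow> (f u, f v) \<in> edges G}"

definition hom_equiv :: "graph set \<Rightarrow> graph \<Rightarrow> graph \<Rightarrow> bool" where
  "hom_equiv \<F> G H \<longleftrightarrow> (\<forall>F\<in>\<F>. hom F G = hom F H)"

definition cl :: "graph set \<Rightarrow> graph set" where
  "cl \<F> = {K. simple_graph K \<and>
      (\<forall>G H. simple_graph G \<longrightarrow> simple_graph H \<longrightarrow> hom_equiv \<F> G H \<longrightarrow> hom K G = hom K H)}"

definition lexprod :: "graph \<Rightarrow> graph \<Rightarrow> graph" where
  "lexprod G H =
    (prod_encode ` (verts G \<times> verts H),
     {(prod_encode (g, h), prod_encode (g', h')) | g h g' h'.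
        g \<in> verts G \<and> g' \<in> verts G \<and> h \<in> verts H \<and> h' \<in> verts H \<and>
        ((g = g' \<and> (h, h') \<in> edges H) \<or> (g, g') \<in> edges G)})"

definition induced :: "graph \<Rightarrow> nat set \<Rightarrow> graph" where
  "induced G S = (S, edges G \<inter> (S \<times> S))"

definition graph_iso :: "graph \<Rightarrow> graph \<Rightarrow> bool" where
  "graph_iso G H \<longleftrightarrow> (\<exists>f. bij_betw f (verts G) (verts H) \<and>
      (\<forall>u\<in>verts G. \<forall>v\<in>verts G. (u, v) \<in> edges G \<longleftrightarrow> (f u, f v) \<in> edges H))"

definition induced_closed :: "graph set \<Rightarrow> bool" where
  "induced_closed \<F> \<longleftrightarrow> (\<forall>K\<in>\<F>. \<forall>S \<subseteq> verts K. \<forall>K'.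
      simple_graph K' \<and> graph_iso K' (induced K S) \<longrightarrow> K' \<in> \<F>)"

definition lex_preserved :: "graph set \<Rightarrow> bool" where
  "lex_preserved \<F> \<longleftrightarrow> (\<forall>G H H'. simple_graph G \<longrightarrow> simple_graph H \<longrightarrow> simple_graph H' \<longrightarrow>
      hom_equiv \<F> H H' \<longrightarrow> hom_equiv \<F> (lexprod G H) (lexprod G H'))"

end

theory Submission
  imports Defs
begin

text \<open>
  A homomorphism \<open>F \<rightarrow> G \<cdot> H\<close> is a map \<open>a : V(F) \<rightarrow> V(G)\<close> sending every edge of \<open>F\<close> to an edge or
  to a single vertex, together with a homomorphism to \<open>H\<close> from the disjoint union \<open>F\<^sub>a\<close> of the
  graphs induced by \<open>F\<close> on the fibres of \<open>a\<close>. Hence \<open>hom(F, G \<cdot> H)\<close> is the sum over \<open>a\<close> of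
  \<open>hom(F\<^sub>a, H)\<close>, where \<open>hom(F\<^sub>a, H)\<close> is the product of the numbers \<open>hom(F[a\<^sup>-\<^sup>1(g)], H)\<close>. This gives
  (1) \<open>\<Longrightarrow>\<close> (2), and (3) \<open>\<Longrightarrow>\<close> (2) since a class and its closure define the same equivalence.

  For (2) \<open>\<Longrightarrow>\<close> (3), let \<open>H\<close> and \<open>H'\<close> be equivalent. As \<open>hom(F, \<cdot>)\<close> is multiplicative with respect to
  the categorical product, \<open>H \<times> H\<close>, \<open>H \<times> H'\<close> and \<open>H' \<times> H'\<close> are equivalent as well, and comparing
  \<open>hom(K, G \<cdot> \<dots>)\<close> on these three graphs yields that the sum over \<open>a\<close> of
  \<open>(hom(K\<^sub>a, H) - hom(K\<^sub>a, H'))\<^sup>2\<close> is zero. So \<open>hom(K\<^sub>a, H) = hom(K\<^sub>a, H')\<close> for every single \<open>a\<close>.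
  With \<open>G\<close> complete, \<open>a\<close> can be chosen to contract exactly \<open>S\<close>, and then \<open>K\<^sub>a\<close> is \<open>K[S]\<close> plus
  isolated vertices.
\<close>

section \<open>Homomorphism sets, auxiliary graphs and their elementary properties\<close>

definition homs :: "graph \<Rightarrow> graph \<Rightarrow> (nat \<Rightarrow> nat) set" where
  "homs F G = {f \<in> verts F \<rightarrow>\<^sub>E verts G.
       \<forall>u v. (u, v) \<in> edges F \<longrightarrow> (f u, f v) \<in> edges G}"

definition catprod :: "graph \<Rightarrow> graph \<Rightarrow> graph" where
  "catprod G H =
    (prod_encode ` (verts G \<times> verts H),
     {(prod_encode (g, h), prod_encode (g', h')) | g h g' h'.
        (g, g') \<in> edges G \<and> (h, h') \<in> edges H})"

text \<open>Deleting the edges between different fibres realises the disjoint union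
  \<open>F\<^sub>a\<close> on the original vertex set, so no vertices need renaming.\<close>

definition fibre_graph :: "graph \<Rightarrow> (nat \<Rightarrow> nat) \<Rightarrow> graph" where
  "fibre_graph F a = (verts F, {(u, v) \<in> edges F. a u = a v})"

text \<open>These are the homomorphisms from \<open>F\<close> to \<open>G\<close> with a loop added
  at every vertex.\<close>

definition weak_homs :: "graph \<Rightarrow> graph \<Rightarrow> (nat \<Rightarrow> nat) set" where
  "weak_homs F G = {a \<in> verts F \<rightarrow>\<^sub>E verts G.
       \<forall>u v. (u, v) \<in> edges F \<longrightarrow> a u = a v \<or> (a u, a v) \<in> edges G}"

definition complete_graph :: "nat set \<Rightarrow> graph" where
  "complete_graph V = (V, {(u, v). u \<in> V \<and> v \<in> V \<and> u \<noteq> v})"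

lemma hom_eq_card_homs: "hom F G = card (homs F G)"
  by (simp add: hom_def homs_def)

lemma homsI:
  assumes "\<And>v. v \<in> verts F \<Longrightarrow> f v \<in> verts G" "\<And>v. v \<notin> verts F \<Longrightarrow> f v = undefined"
    and "\<And>u v. (u, v) \<in> edges F \<Longrightarrow> (f u, f v) \<in> edges G"
  shows "f \<in> homs F G"
  using assms by (auto simp: homs_def)

lemma homs_verts: "f \<in> homs F G \<Longrightarrow> v \<in> verts F \<Longrightarrow> f v \<in> verts G"
  by (auto simp: homs_def)

lemma homs_undefined: "f \<in> homs F G \<Longrightarrow> v \<notin> verts F \<Longrightarrow> f v = undefined"
  by (auto simp: homs_def PiE_def extensional_def)

lemma homs_edges: "f \<in> homs F G \<Longrightarrow> (u, v) \<in> edges F \<Longrightarrow> (f u, f v) \<in> edges G"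
  by (auto simp: homs_def)

lemma simple_graph_edge_verts:
  assumes "simple_graph G" "(u, v) \<in> edges G"
  shows "u \<in> verts G" "v \<in> verts G"
  using assms by (auto simp: simple_graph_def)

lemma simple_graph_finite_verts: "simple_graph G \<Longrightarrow> finite (verts G)"
  by (simp add: simple_graph_def)

lemma finite_homs: "finite (verts F) \<Longrightarrow> finite (verts G) \<Longrightarrow> finite (homs F G)"
  unfolding homs_def by (simp add: finite_PiE)

lemma finite_weak_homs: "finite (verts F) \<Longrightarrow> finite (verts G) \<Longrightarrow> finite (weak_homs F G)"
  unfolding weak_homs_def by (simp add: finite_PiE)

lemma verts_induced [simp]: "verts (induced G S) = S"
  and edges_induced [simp]: "edges (induced G S) = edges G \<inter> (S \<times> S)"
  by (simp_all add: induced_def verts_def edges_def)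

lemma verts_fibre_graph [simp]: "verts (fibre_graph F a) = verts F"
  and edges_fibre_graph [simp]: "edges (fibre_graph F a) = {(u, v) \<in> edges F. a u = a v}"
  by (simp_all add: fibre_graph_def verts_def edges_def)

lemma verts_catprod [simp]: "verts (catprod G H) = prod_encode ` (verts G \<times> verts H)"
  by (simp add: catprod_def verts_def)

lemma edges_catprod_iff [simp]:
  "(prod_encode (g, h), prod_encode (g', h')) \<in> edges (catprod G H) \<longleftrightarrow>
     (g, g') \<in> edges G \<and> (h, h') \<in> edges H"
  by (auto simp: catprod_def edges_def)

lemma verts_lexprod [simp]: "verts (lexprod G H) = prod_encode ` (verts G \<times> verts H)"
  by (simp add: lexprod_def verts_def)

lemma edges_lexprod_iff [simp]:
  "(prod_encode (g, h), prod_encode (g', h')) \<in> edges (lexprod G H) \<longleftrightarrow>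
     g \<in> verts G \<and> g' \<in> verts G \<and> h \<in> verts H \<and> h' \<in> verts H \<and>
     ((g = g' \<and> (h, h') \<in> edges H) \<or> (g, g') \<in> edges G)"
  by (auto simp: lexprod_def edges_def)

lemma prod_encode_image_decode:
  "x \<in> prod_encode ` (A \<times> B) \<Longrightarrow> fst (prod_decode x) \<in> A \<and> snd (prod_decode x) \<in> B"
  by auto

lemma edges_lexprod_decode:
  "(x, y) \<in> edges (lexprod G H) \<Longrightarrow>
     fst (prod_decode x) = fst (prod_decode y)
       \<and> (snd (prod_decode x), snd (prod_decode y)) \<in> edges H
     \<or> (fst (prod_decode x), fst (prod_decode y)) \<in> edges G"
  by (auto simp: lexprod_def edges_def)

lemma edges_catprod_decode:
  "(x, y) \<in> edges (catprod G H) \<Longrightarrow>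
     (fst (prod_decode x), fst (prod_decode y)) \<in> edges G
     \<and> (snd (prod_decode x), snd (prod_decode y)) \<in> edges H"
  by (auto simp: catprod_def edges_def)

lemma verts_complete_graph [simp]: "verts (complete_graph V) = V"
  and edges_complete_graph [simp]:
    "edges (complete_graph V) = {(u, v). u \<in> V \<and> v \<in> V \<and> u \<noteq> v}"
  by (simp_all add: complete_graph_def verts_def edges_def)

lemma simple_graph_complete_graph: "finite V \<Longrightarrow> simple_graph (complete_graph V)"
  by (auto simp: simple_graph_def)

lemma simple_graph_induced:
  "simple_graph G \<Longrightarrow> S \<subseteq> verts G \<Longrightarrow> simple_graph (induced G S)"
  by (auto simp: simple_graph_def finite_subset)

lemma simple_graph_catprod:
  assumes "simple_graph G" "simple_graph H"
  shows "simple_graph (catprod G H)"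
  using assms unfolding simple_graph_def
  by (auto simp: catprod_def verts_def edges_def)

lemma simple_graph_lexprod:
  assumes "simple_graph G" "simple_graph H"
  shows "simple_graph (lexprod G H)"
  using assms unfolding simple_graph_def
  by (auto simp: lexprod_def verts_def edges_def)

section \<open>Counting homomorphisms: isomorphic sources, products, fibre graphs\<close>

lemma hom_graph_iso:
  assumes "graph_iso F F'" "simple_graph F" "simple_graph F'"
  shows "hom F G = hom F' G"
proof -
  from assms(1) obtain \<phi> where bij: "bij_betw \<phi> (verts F) (verts F')"
    and iso: "\<And>u v. u \<in> verts F \<Longrightarrow> v \<in> verts F \<Longrightarrow> (u, v) \<in> edges F \<longleftrightarrow> (\<phi> u, \<phi> v) \<in> edges F'"
    unfolding graph_iso_def by blast
  define \<psi> where "\<psi> = inv_into (verts F) \<phi>"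
  have \<phi>: "\<phi> v \<in> verts F'" "\<psi> (\<phi> v) = v" if "v \<in> verts F" for v
    using that bij by (auto simp: \<psi>_def bij_betw_def)
  have \<psi>: "\<psi> v \<in> verts F" "\<phi> (\<psi> v) = v" if "v \<in> verts F'" for v
    using that bij by (auto simp: \<psi>_def bij_betw_def f_inv_into_f inv_into_into)
  have "bij_betw (\<lambda>f. \<lambda>v\<in>verts F'. f (\<psi> v)) (homs F G) (homs F' G)"
  proof (rule bij_betw_byWitness[where f' = "\<lambda>f. \<lambda>v\<in>verts F. f (\<phi> v)"])
    show "\<forall>f\<in>homs F G. (\<lambda>v\<in>verts F. (\<lambda>v\<in>verts F'. f (\<psi> v)) (\<phi> v)) = f"
      using \<phi> by (auto simp: fun_eq_iff homs_undefined)
    show "\<forall>f\<in>homs F' G. (\<lambda>v\<in>verts F'. (\<lambda>v\<in>verts F. f (\<phi> v)) (\<psi> v)) = f"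
      using \<psi> by (auto simp: fun_eq_iff homs_undefined)
    show "(\<lambda>f. \<lambda>v\<in>verts F'. f (\<psi> v)) ` homs F G \<subseteq> homs F' G"
    proof clarify
      fix f assume f: "f \<in> homs F G"
      show "(\<lambda>v\<in>verts F'. f (\<psi> v)) \<in> homs F' G"
      proof (rule homsI)
        fix u v assume uv: "(u, v) \<in> edges F'"
        note V = simple_graph_edge_verts[OF assms(3) uv]
        have "(\<psi> u, \<psi> v) \<in> edges F"
          using iso[of "\<psi> u" "\<psi> v"] \<psi> V uv by simp
        then show "((\<lambda>v\<in>verts F'. f (\<psi> v)) u, (\<lambda>v\<in>verts F'. f (\<psi> v)) v) \<in> edges G"
          using homs_edges[OF f] V by simp
      qed (use \<psi> homs_verts[OF f] in auto)
    qed
    show "(\<lambda>f. \<lambda>v\<in>verts F. f (\<phi> v)) ` homs F' G \<subseteq> homs F G"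
    proof clarify
      fix f assume f: "f \<in> homs F' G"
      show "(\<lambda>v\<in>verts F. f (\<phi> v)) \<in> homs F G"
      proof (rule homsI)
        fix u v assume uv: "(u, v) \<in> edges F"
        note V = simple_graph_edge_verts[OF assms(2) uv]
        have "(\<phi> u, \<phi> v) \<in> edges F'"
          using iso V uv by simp
        then show "((\<lambda>v\<in>verts F. f (\<phi> v)) u, (\<lambda>v\<in>verts F. f (\<phi> v)) v) \<in> edges G"
          using homs_edges[OF f] V by simp
      qed (use \<phi> homs_verts[OF f] in auto)
    qed
  qed
  then show ?thesis
    by (simp add: hom_eq_card_homs bij_betw_same_card)
qed

lemma hom_catprod:
  assumes "simple_graph F"
  shows "hom F (catprod G H) = hom F G * hom F H"
proof -
  note E = simple_graph_edge_verts[OF assms]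
  have "bij_betw (\<lambda>(p, q). \<lambda>v\<in>verts F. prod_encode (p v, q v))
      (homs F G \<times> homs F H) (homs F (catprod G H))"
  proof (rule bij_betw_byWitness[where f' =
        "\<lambda>f. (\<lambda>v\<in>verts F. fst (prod_decode (f v)), \<lambda>v\<in>verts F. snd (prod_decode (f v)))"])
    show "(\<lambda>(p, q). \<lambda>v\<in>verts F. prod_encode (p v, q v)) ` (homs F G \<times> homs F H)
        \<subseteq> homs F (catprod G H)"
      using E by (auto intro!: homsI simp: homs_verts homs_edges)
    show "(\<lambda>f. (\<lambda>v\<in>verts F. fst (prod_decode (f v)), \<lambda>v\<in>verts F. snd (prod_decode (f v)))) `
        homs F (catprod G H) \<subseteq> homs F G \<times> homs F H"
    proof clarify
      fix f assume f: "f \<in> homs F (catprod G H)"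
      have v: "fst (prod_decode (f v)) \<in> verts G \<and> snd (prod_decode (f v)) \<in> verts H"
        if "v \<in> verts F" for v
        using homs_verts[OF f that] by (intro prod_encode_image_decode) simp
      have e: "(fst (prod_decode (f u)), fst (prod_decode (f v))) \<in> edges G \<and>
          (snd (prod_decode (f u)), snd (prod_decode (f v))) \<in> edges H"
        if "(u, v) \<in> edges F" for u v
        using homs_edges[OF f that] by (rule edges_catprod_decode)
      show "(\<lambda>v\<in>verts F. fst (prod_decode (f v))) \<in> homs F G \<and>
          (\<lambda>v\<in>verts F. snd (prod_decode (f v))) \<in> homs F H"
        using E v e by (auto intro!: homsI)
    qed
  qed (auto simp: fun_eq_iff homs_undefined)
  then show ?thesis
    by (simp add: hom_eq_card_homs bij_betw_same_card[symmetric] card_cartesian_product)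
qed

text \<open>Split a homomorphism into its coordinates \<open>a\<close> and \<open>b\<close>. An edge
  of \<open>F\<close> restricts \<open>b\<close> only if \<open>a\<close> agrees on its ends, that
  is, if it is an edge of \<open>fibre_graph F a\<close>. The range of \<open>b\<close> thus depends
  on \<open>a\<close>, and a dependent sum is counted.\<close>

lemma hom_lexprod:
  assumes F: "simple_graph F" and G: "simple_graph G" and H: "finite (verts H)"
  shows "hom F (lexprod G H) = (\<Sum>a\<in>weak_homs F G. hom (fibre_graph F a) H)"
proof -
  note E = simple_graph_edge_verts[OF F]
  have "bij_betw (\<lambda>(a, b). \<lambda>v\<in>verts F. prod_encode (a v, b v))
      (SIGMA a:weak_homs F G. homs (fibre_graph F a) H) (homs F (lexprod G H))"
  proof (rule bij_betw_byWitness[where f' =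
        "\<lambda>f. (\<lambda>v\<in>verts F. fst (prod_decode (f v)), \<lambda>v\<in>verts F. snd (prod_decode (f v)))"])
    show "(\<lambda>(a, b). \<lambda>v\<in>verts F. prod_encode (a v, b v)) `
        (SIGMA a:weak_homs F G. homs (fibre_graph F a) H) \<subseteq> homs F (lexprod G H)"
    proof clarify
      fix a b assume a: "a \<in> weak_homs F G" and b: "b \<in> homs (fibre_graph F a) H"
      show "(\<lambda>v\<in>verts F. prod_encode (a v, b v)) \<in> homs F (lexprod G H)"
      proof (rule homsI)
        fix u v assume uv: "(u, v) \<in> edges F"
        have "a u = a v \<and> (b u, b v) \<in> edges H \<or> (a u, a v) \<in> edges G"
          using a uv homs_edges[OF b, of u v] by (auto simp: weak_homs_def)
        moreover have "a u \<in> verts G" "a v \<in> verts G" "b u \<in> verts H" "b v \<in> verts H"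
          using a homs_verts[OF b] E[OF uv] by (auto simp: weak_homs_def)
        ultimately show "((\<lambda>v\<in>verts F. prod_encode (a v, b v)) u,
            (\<lambda>v\<in>verts F. prod_encode (a v, b v)) v) \<in> edges (lexprod G H)"
          using E[OF uv] by simp
      qed (use a homs_verts[OF b] in \<open>auto simp: weak_homs_def\<close>)
    qed
    show "(\<lambda>f. (\<lambda>v\<in>verts F. fst (prod_decode (f v)), \<lambda>v\<in>verts F. snd (prod_decode (f v)))) `
        homs F (lexprod G H) \<subseteq> (SIGMA a:weak_homs F G. homs (fibre_graph F a) H)"
    proof clarify
      fix f assume f: "f \<in> homs F (lexprod G H)"
      \<comment> \<open>On an edge inside a fibre the first coordinates coincide. Since
        \<open>G\<close> has no loops, the second alternative in \<open>e\<close> is then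
        impossible.\<close>
      have irr: "(g, g) \<notin> edges G" for g
        using G by (simp add: simple_graph_def)
      have v: "fst (prod_decode (f v)) \<in> verts G \<and> snd (prod_decode (f v)) \<in> verts H"
        if "v \<in> verts F" for v
        using homs_verts[OF f that] by (intro prod_encode_image_decode) simp
      have e: "fst (prod_decode (f u)) = fst (prod_decode (f v))
            \<and> (snd (prod_decode (f u)), snd (prod_decode (f v))) \<in> edges H
          \<or> (fst (prod_decode (f u)), fst (prod_decode (f v))) \<in> edges G"
        if "(u, v) \<in> edges F" for u v
        using homs_edges[OF f that] by (rule edges_lexprod_decode)
      show "(\<lambda>v\<in>verts F. fst (prod_decode (f v))) \<in> weak_homs F G \<and>
          (\<lambda>v\<in>verts F. snd (prod_decode (f v)))
            \<in> homs (fibre_graph F (\<lambda>v\<in>verts F. fst (prod_decode (f v)))) H"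
      proof
        show "(\<lambda>v\<in>verts F. fst (prod_decode (f v))) \<in> weak_homs F G"
          using E v by (auto simp: weak_homs_def dest: e)
        show "(\<lambda>v\<in>verts F. snd (prod_decode (f v)))
            \<in> homs (fibre_graph F (\<lambda>v\<in>verts F. fst (prod_decode (f v)))) H"
        proof (rule homsI)
          fix u v assume "(u, v) \<in> edges (fibre_graph F (\<lambda>v\<in>verts F. fst (prod_decode (f v))))"
          then show "((\<lambda>v\<in>verts F. snd (prod_decode (f v))) u,
              (\<lambda>v\<in>verts F. snd (prod_decode (f v))) v) \<in> edges H"
            using E[of u v] e[of u v] irr by auto
        qed (use v in auto)
      qed
    qed
  qed (auto simp: fun_eq_iff homs_undefined weak_homs_def PiE_def extensional_def)
  then have "card (homs F (lexprod G H)) = card (SIGMA a:weak_homs F G. homs (fibre_graph F a) H)"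
    by (simp add: bij_betw_same_card)
  also have "\<dots> = (\<Sum>a\<in>weak_homs F G. card (homs (fibre_graph F a) H))"
    using F G H by (intro card_SigmaI finite_weak_homs ballI finite_homs)
      (auto simp: simple_graph_def)
  finally show ?thesis
    by (simp add: hom_eq_card_homs)
qed

text \<open>No edge joins two fibres, so a homomorphism is an independent choice on each of them.
  The index set \<open>I\<close> may exceed the image of \<open>a\<close>, because an empty fibre
  contributes a factor 1.\<close>

lemma hom_fibre_graph:
  assumes F: "simple_graph F" and I: "finite I" "a ` verts F \<subseteq> I"
  shows "hom (fibre_graph F a) H = (\<Prod>i\<in>I. hom (induced F {v \<in> verts F. a v = i}) H)"
proof -
  note E = simple_graph_edge_verts[OF F]
  let ?P = "\<lambda>i. homs (induced F {v \<in> verts F. a v = i}) H"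
  let ?f = "\<lambda>f. \<lambda>i\<in>I. restrict f {v \<in> verts F. a v = i}"
  let ?g = "\<lambda>\<phi>. \<lambda>v\<in>verts F. \<phi> (a v) v"
  have "bij_betw ?f (homs (fibre_graph F a) H) (\<Pi>\<^sub>E i\<in>I. ?P i)"
  proof (rule bij_betw_byWitness[where f' = ?g])
    show "\<forall>f\<in>homs (fibre_graph F a) H. ?g (?f f) = f"
      using I(2) by (auto simp: fun_eq_iff homs_undefined)
    show "\<forall>\<phi>\<in>\<Pi>\<^sub>E i\<in>I. ?P i. ?f (?g \<phi>) = \<phi>"
    proof
      fix \<phi> assume \<phi>: "\<phi> \<in> (\<Pi>\<^sub>E i\<in>I. ?P i)"
      have "?f (?g \<phi>) i v = \<phi> i v" for i v
      proof (cases "i \<in> I")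
        case True
        then have "\<phi> i \<in> ?P i" using \<phi> by auto
        then show ?thesis using True homs_undefined[of "\<phi> i" _ _ v] by auto
      next
        case False
        then show ?thesis using \<phi> by (auto simp: PiE_def extensional_def)
      qed
      then show "?f (?g \<phi>) = \<phi>" by blast
    qed
    show "?f ` homs (fibre_graph F a) H \<subseteq> (\<Pi>\<^sub>E i\<in>I. ?P i)"
      by (auto intro!: homsI simp: homs_verts homs_edges)
    show "?g ` (\<Pi>\<^sub>E i\<in>I. ?P i) \<subseteq> homs (fibre_graph F a) H"
    proof clarify
      fix \<phi> assume \<phi>: "\<phi> \<in> (\<Pi>\<^sub>E i\<in>I. ?P i)"
      have P: "\<phi> (a v) \<in> ?P (a v)" if "v \<in> verts F" for v
        using \<phi> I(2) that by blast
      show "?g \<phi> \<in> homs (fibre_graph F a) H"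
      proof (rule homsI)
        fix u v assume "(u, v) \<in> edges (fibre_graph F a)"
        then have uv: "(u, v) \<in> edges F" "a u = a v" by auto
        then show "(?g \<phi> u, ?g \<phi> v) \<in> edges H"
          using homs_edges[OF P, of u u v] E[OF uv(1)] by auto
      next
        fix v assume "v \<in> verts (fibre_graph F a)"
        then show "?g \<phi> v \<in> verts H"
          using homs_verts[OF P, of v v] by auto
      qed auto
    qed
  qed
  then show ?thesis
    using I(1) by (simp add: hom_eq_card_homs bij_betw_same_card card_PiE)
qed

lemma hom_induced_empty: "hom (induced F {}) G = 1"
  by (simp add: hom_def)

lemma hom_induced_singleton:
  assumes "simple_graph F"
  shows "hom (induced F {v}) G = card (verts G)"
proof -
  have "homs (induced F {v}) G = {v} \<rightarrow>\<^sub>E verts G"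
    using assms by (auto simp: homs_def simple_graph_def)
  then show ?thesis
    by (simp add: hom_eq_card_homs card_PiE)
qed

text \<open>The fresh label \<open>m\<close> gathers \<open>S\<close> into one fibre without
  absorbing any other vertex. The vertices outside \<open>S\<close> keep their own labels and become
  isolated.\<close>

lemma hom_fibre_graph_contract:
  assumes K: "simple_graph K" and S: "S \<subseteq> verts K" and m: "m \<notin> verts K"
  shows "hom (fibre_graph K (\<lambda>v\<in>verts K. if v \<in> S then m else v)) H =
         hom (induced K S) H * card (verts H) ^ card (verts K - S)"
proof -
  let ?a = "\<lambda>v\<in>verts K. if v \<in> S then m else v"
  have fin: "finite (verts K)" using K by (rule simple_graph_finite_verts)
  have "hom (fibre_graph K ?a) H =
      (\<Prod>i\<in>insert m (verts K). hom (induced K {v \<in> verts K. ?a v = i}) H)"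
    using fin by (intro hom_fibre_graph K) auto
  also have "\<dots> = hom (induced K {v \<in> verts K. ?a v = m}) H
      * (\<Prod>i\<in>verts K. hom (induced K {v \<in> verts K. ?a v = i}) H)"
    using fin m by simp
  also have "{v \<in> verts K. ?a v = m} = S"
    using S m by auto
  also have "(\<Prod>i\<in>verts K. hom (induced K {v \<in> verts K. ?a v = i}) H)
      = (\<Prod>i\<in>verts K. if i \<in> S then 1 else card (verts H))"
  proof (rule prod.cong[OF refl])
    fix i assume i: "i \<in> verts K"
    \<comment> \<open>A vertex of \<open>S\<close> is relabelled, so its own name is a label with
      empty fibre; any other vertex is alone in its fibre.\<close>
    have "{v \<in> verts K. ?a v = i} = (if i \<in> S then {} else {i})"
      using i m by (auto split: if_splits)
    then show "hom (induced K {v \<in> verts K. ?a v = i}) H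
        = (if i \<in> S then 1 else card (verts H))"
      using hom_induced_empty hom_induced_singleton[OF K] by simp
  qed
  also have "\<dots> = (\<Prod>i\<in>verts K - S. card (verts H))"
    using fin by (intro prod.mono_neutral_cong_right) auto
  finally show ?thesis by (simp only: prod_constant)
qed

section \<open>Closure under induced subgraphs implies preservation\<close>

lemma induced_closed_induced:
  assumes "induced_closed \<F>" "K \<in> \<F>" "simple_graph K" "S \<subseteq> verts K"
  shows "induced K S \<in> \<F>"
proof -
  have "graph_iso (induced K S) (induced K S)"
    unfolding graph_iso_def by (rule exI[of _ id]) auto
  then show ?thesis
    using assms simple_graph_induced unfolding induced_closed_def by blast
qed

text \<open>The index set \<open>weak_homs F G\<close> does not involve \<open>H\<close>, so the two
  sums can be compared term by term, and each term factor by factor.\<close>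

lemma induced_closed_imp_lex_preserved:
  assumes simple: "\<forall>K\<in>\<F>. simple_graph K" and closed: "induced_closed \<F>"
  shows "lex_preserved \<F>"
  unfolding lex_preserved_def hom_equiv_def
proof (intro allI impI ballI)
  fix G H H' F
  assume G: "simple_graph G" and H: "simple_graph H" "simple_graph H'"
    and eq: "\<forall>F\<in>\<F>. hom F H = hom F H'" and F: "F \<in> \<F>"
  have sF: "simple_graph F" using simple F by blast
  have "hom (fibre_graph F a) H = hom (fibre_graph F a) H'" if "a \<in> weak_homs F G" for a
  proof -
    have a: "a ` verts F \<subseteq> verts G"
      using that by (auto simp: weak_homs_def)
    have "hom (induced F {v \<in> verts F. a v = g}) H = hom (induced F {v \<in> verts F. a v = g}) H'" for g
      using eq induced_closed_induced[OF closed F sF] by auto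
    then show ?thesis
      using hom_fibre_graph[OF sF simple_graph_finite_verts[OF G] a] by simp
  qed
  then show "hom F (lexprod G H) = hom F (lexprod G H')"
    using hom_lexprod[OF sF G] H by (simp add: simple_graph_finite_verts)
qed

section \<open>Passing between a class and its closure\<close>

lemma hom_equiv_cl:
  assumes "\<forall>K\<in>\<F>. simple_graph K" "simple_graph G" "simple_graph H"
  shows "hom_equiv (cl \<F>) G H \<longleftrightarrow> hom_equiv \<F> G H"
  using assms unfolding hom_equiv_def cl_def by blast

text \<open>The property depends on the class only through \<open>hom_equiv\<close> on simple
  graphs, and lexicographic products of simple graphs are simple.\<close>

lemma lex_preserved_cl:
  assumes "\<forall>K\<in>\<F>. simple_graph K"
  shows "lex_preserved (cl \<F>) \<longleftrightarrow> lex_preserved \<F>"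
  unfolding lex_preserved_def
  by (meson hom_equiv_cl[OF assms] simple_graph_lexprod)

section \<open>Preservation implies that the closure is closed under induced subgraphs\<close>

lemma hom_equiv_catprod:
  assumes "\<forall>K\<in>\<F>. simple_graph K" "hom_equiv \<F> G G'" "hom_equiv \<F> H H'"
  shows "hom_equiv \<F> (catprod G H) (catprod G' H')"
  using assms by (simp add: hom_equiv_def hom_catprod)

text \<open>The hypotheses make the sum of the squared differences vanish, hence every summand. The
  computation is done in \<open>int\<close> because subtraction on \<open>nat\<close>
  truncates.\<close>

lemma sum_eq_products_imp_eq:
  fixes x y :: "'a \<Rightarrow> nat"
  assumes "finite A" "(\<Sum>a\<in>A. x a * x a) = (\<Sum>a\<in>A. x a * y a)"
    "(\<Sum>a\<in>A. y a * y a) = (\<Sum>a\<in>A. x a * y a)" "a \<in> A"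
  shows "x a = y a"
proof -
  have "(\<Sum>a\<in>A. (int (x a) - int (y a))\<^sup>2) =
      int (\<Sum>a\<in>A. x a * x a) + int (\<Sum>a\<in>A. y a * y a) - 2 * int (\<Sum>a\<in>A. x a * y a)"
    by (simp add: power2_eq_square algebra_simps sum_subtractf sum.distrib sum_distrib_left)
  also have "\<dots> = 0" using assms by simp
  finally have "\<forall>a\<in>A. (int (x a) - int (y a))\<^sup>2 = 0"
    using assms(1) by (subst (asm) sum_nonneg_eq_0_iff) auto
  with assms(4) show ?thesis by simp
qed

lemma lex_preserved_hom_fibre_graph_eq:
  assumes simple: "\<forall>K\<in>\<F>. simple_graph K" and lex: "lex_preserved \<F>" and K: "K \<in> cl \<F>"
    and G: "simple_graph G" and H: "simple_graph H" "simple_graph H'" "hom_equiv \<F> H H'"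
    and a: "a \<in> weak_homs K G"
  shows "hom (fibre_graph K a) H = hom (fibre_graph K a) H'"
proof -
  have sK: "simple_graph K" using K by (simp add: cl_def)
  have sKa: "simple_graph (fibre_graph K a)" for a
    using sK by (auto simp: simple_graph_def)
  \<comment> \<open>Applying preservation to categorical products turns an identity between sums of
    counts into one between sums of products of counts.\<close>
  have sum_eq: "(\<Sum>a\<in>weak_homs K G. hom (fibre_graph K a) X * hom (fibre_graph K a) Y)
      = (\<Sum>a\<in>weak_homs K G. hom (fibre_graph K a) X' * hom (fibre_graph K a) Y')"
    if s: "simple_graph X" "simple_graph Y" "simple_graph X'" "simple_graph Y'"
      and eq: "hom_equiv \<F> X X'" "hom_equiv \<F> Y Y'" for X Y X' Y'
  proof -
    have s': "simple_graph (catprod X Y)" "simple_graph (catprod X' Y')"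
      using s by (simp_all add: simple_graph_catprod)
    have "hom_equiv \<F> (lexprod G (catprod X Y)) (lexprod G (catprod X' Y'))"
      using lex G s' hom_equiv_catprod[OF simple eq] unfolding lex_preserved_def by blast
    then have "hom K (lexprod G (catprod X Y)) = hom K (lexprod G (catprod X' Y'))"
      using K simple_graph_lexprod[OF G] s' unfolding cl_def by blast
    then show ?thesis
      unfolding s'[THEN simple_graph_finite_verts, THEN hom_lexprod[OF sK G]] hom_catprod[OF sKa] .
  qed
  have refl: "hom_equiv \<F> X X" for X by (simp add: hom_equiv_def)
  have sym: "hom_equiv \<F> H' H" using H(3) by (simp add: hom_equiv_def)
  \<comment> \<open>The two uses of \<open>sum_eq\<close> replace one factor each: \<open>H\<close>,
    \<open>H\<close> by \<open>H\<close>, \<open>H'\<close>, and \<open>H'\<close>,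
    \<open>H'\<close> by \<open>H\<close>, \<open>H'\<close>.\<close>
  show ?thesis
    by (rule sum_eq_products_imp_eq[OF finite_weak_homs sum_eq sum_eq a])
      (use sK G H refl sym in \<open>simp_all add: simple_graph_finite_verts\<close>)
qed

text \<open>Contracting \<open>S\<close> gives the claim up to a power of the number of vertices of
  the target. Contracting the empty set shows that these numbers agree, so the power can be
  cancelled unless it is zero.\<close>

lemma lex_preserved_imp_hom_induced_eq:
  assumes simple: "\<forall>K\<in>\<F>. simple_graph K" and lex: "lex_preserved \<F>" and K: "K \<in> cl \<F>"
    and S: "S \<subseteq> verts K" and H: "simple_graph H" "simple_graph H'" "hom_equiv \<F> H H'"
  shows "hom (induced K S) H = hom (induced K S) H'"
proof -
  have sK: "simple_graph K" using K by (simp add: cl_def)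
  have fin: "finite (verts K)" using sK by (rule simple_graph_finite_verts)
  obtain m where m: "m \<notin> verts K"
    using ex_new_if_finite[OF infinite_UNIV_nat fin] by blast
  have eq: "hom (induced K T) H * card (verts H) ^ card (verts K - T)
      = hom (induced K T) H' * card (verts H') ^ card (verts K - T)" if "T \<subseteq> verts K" for T
  proof -
    \<comment> \<open>Into a complete graph every map is a weak homomorphism: two images are equal
      or adjacent.\<close>
    have "(\<lambda>v\<in>verts K. if v \<in> T then m else v)
        \<in> weak_homs K (complete_graph (insert m (verts K)))"
      using simple_graph_edge_verts[OF sK] by (auto simp: weak_homs_def)
    then show ?thesis
      using lex_preserved_hom_fibre_graph_eq[OF simple lex K _ H]
        simple_graph_complete_graph fin hom_fibre_graph_contract[OF sK that m]
      by (metis finite_insert)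
  qed
  show ?thesis
  \<comment> \<open>Taking roots of the vertex powers below needs a positive exponent.\<close>
  proof (cases "verts K = {}")
    case True
    then show ?thesis using S by (simp add: hom_induced_empty)
  next
    case False
    have "card (verts H) ^ card (verts K) = card (verts H') ^ card (verts K)"
      using eq[of "{}"] by (simp add: hom_induced_empty)
    moreover have "card (verts K) > 0" using False fin by (simp add: card_gt_0_iff)
    ultimately have card_eq: "card (verts H) = card (verts H')"
      using power_eq_imp_eq_base by blast
    show ?thesis
    \<comment> \<open>A zero factor cannot be cancelled, but then both graphs are empty and hence
      equal.\<close>
    proof (cases "card (verts H) = 0")
      case True
      then have "verts H = {}" "verts H' = {}"
        using card_eq H by (auto dest: simple_graph_finite_verts)
      then have "H = H'"
        using H by (auto simp: simple_graph_def verts_def edges_def prod_eq_iff)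
      then show ?thesis by simp
    next
      case False
      then show ?thesis using eq[OF S] card_eq by simp
    qed
  qed
qed

text \<open>Since \<open>induced_closed\<close> includes isomorphic copies, invariance of
  \<open>hom\<close> under isomorphism of the source is needed as well.\<close>

lemma lex_preserved_imp_induced_closed_cl:
  assumes simple: "\<forall>K\<in>\<F>. simple_graph K" and lex: "lex_preserved \<F>"
  shows "induced_closed (cl \<F>)"
  unfolding induced_closed_def
proof (intro ballI allI impI)
  fix K S K' assume K: "K \<in> cl \<F>" and S: "S \<subseteq> verts K"
    and K': "simple_graph K' \<and> graph_iso K' (induced K S)"
  have "simple_graph (induced K S)"
    using K S by (simp add: cl_def simple_graph_induced)
  then have "hom K' G = hom (induced K S) G" for G
    using K' by (blast intro: hom_graph_iso)
  then show "K' \<in> cl \<F>"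
    using K' lex_preserved_imp_hom_induced_eq[OF simple lex K S] by (simp add: cl_def)
qed

theorem theorem14:
  fixes \<F> :: "graph set"
  assumes "\<forall>K\<in>\<F>. simple_graph K"
  shows "(induced_closed \<F> \<longrightarrow> lex_preserved \<F>)
         \<and> (lex_preserved \<F> \<longleftrightarrow> induced_closed (cl \<F>))"
proof -
  have "\<forall>K\<in>cl \<F>. simple_graph K" by (simp add: cl_def)
  \<comment> \<open>The first implication is applied to \<open>cl \<F>\<close>, itself a class of
    simple graphs, and the result carries over to \<open>\<F>\<close>.\<close>
  then have "lex_preserved \<F>" if "induced_closed (cl \<F>)"
    using induced_closed_imp_lex_preserved that lex_preserved_cl[OF assms] by blast
  then show ?thesis
    using induced_closed_imp_lex_preserved[OF assms] lex_preserved_imp_induced_closed_cl[OF assms]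
    by blast
qed

end
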